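(* Let $E$ and $E_L$ be finite-dimensional vector spaces over $\mathbb R$ or $\mathbb C$. Let $P\in\mathrm{Lin}(E,E)$ be an affine projection, $B\in\mathrm{Lin}(E,E)$ an invertible operator, $F\in E$, and $D\in\mathrm{Lin}(E,E_L)$. Consider the linear equations in $\eta\in E$ $$PB\eta=-PF,\qquad D\eta=0.$$ If $H\in\mathrm{Lin}(E_L,E)$ is such that $PH=0$ and $DB^{-1}H$ is invertible, then $$\eta=-B^{-1}F+B^{-1}H(DB^{-1}H)^{-1}DB^{-1}F$$ solves these equations.
   Context: $\mathrm{Lin}(V,W)$ is the space of linear maps from $V$ to $W$. An operator $P\in\mathrm{Lin}(E,E)$ is called an affine projection if $P^2=P$. *)

theory Defs
  imports Complex_Main
begin

text \<open>
  A vector space is a type of class \<open>ab_group_add\<close> together with a scalar multiplication,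
  as in the locales of \<open>HOL.Vector_Spaces\<close>, so that the real and the complex
  case use the same notions.
\<close>

definition fin_dim :: "('k::field \<Rightarrow> 'a::ab_group_add \<Rightarrow> 'a) \<Rightarrow> bool" where
  "fin_dim s \<longleftrightarrow> (\<exists>Basis. finite_dimensional_vector_space s Basis)"

definition Lin :: "('k::field \<Rightarrow> 'a::ab_group_add \<Rightarrow> 'a) \<Rightarrow> ('k \<Rightarrow> 'b::ab_group_add \<Rightarrow> 'b)
    \<Rightarrow> ('a \<Rightarrow> 'b) set" where
  "Lin s t = {f. Vector_Spaces.linear s t f}"

definition affine_projection :: "('k::field \<Rightarrow> 'a::ab_group_add \<Rightarrow> 'a) \<Rightarrow> ('a \<Rightarrow> 'a) \<Rightarrow> bool" where
  "affine_projection s P \<longleftrightarrow> P \<in> Lin s s \<and> P \<circ> P = P"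

text \<open>
  The inverse of such an \<open>A\<close> is \<open>inv A\<close>, since the two-sided inverse is unique.
\<close>

definition invertible_op :: "('k::field \<Rightarrow> 'a::ab_group_add \<Rightarrow> 'a) \<Rightarrow> ('a \<Rightarrow> 'a) \<Rightarrow> bool" where
  "invertible_op s A \<longleftrightarrow> A \<in> Lin s s \<and> (\<exists>A' \<in> Lin s s. A' \<circ> A = id \<and> A \<circ> A' = id)"

end

theory Submission imports Defs begin

text \<open>
  Write \<open>\<eta> = B\<inverse>(H \<lambda> - F)\<close> with \<open>\<lambda> \<in> E\<^sub>L\<close> to be chosen; \<open>\<lambda>\<close> acts as a Lagrange multiplier
  for the constraint \<open>D \<eta> = 0\<close>.  The first equation holds whatever \<open>\<lambda>\<close> is, because
  \<open>B \<eta> = H \<lambda> - F\<close> and \<open>P\<close> annihilates the range of \<open>H\<close>.  The second one reads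
  \<open>(D B\<inverse> H) \<lambda> = D B\<inverse> F\<close>, and the stated formula takes for \<open>\<lambda>\<close> the solution of this equation.
  The computation is the same over every field.
\<close>

lemma Lin_diff: "f \<in> Lin s t \<Longrightarrow> f (x - y) = f x - f y"
  by (simp add: Lin_def linear_iff_module_hom module_hom.diff)

lemma invertible_op_inv_right:
  assumes "invertible_op s A"
  shows "A (inv A x) = x"
proof -
  have "surj A"
    using assms unfolding invertible_op_def by (metis comp_apply id_apply surjI)
  then show ?thesis
    by (rule surj_f_inv_f)
qed

lemma multiplier_solves_constrained_equation:
  assumes P: "P \<in> Lin s s" and B: "invertible_op s B" and D: "D \<in> Lin s t"
    and PH: "\<And>x. P (H x) = 0" and S: "invertible_op t (D \<circ> inv B \<circ> H)"
    and \<eta>: "\<eta> = - inv B F + inv B (H (inv (D \<circ> inv B \<circ> H) (D (inv B F))))"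
  shows "P (B \<eta>) = - P F \<and> D \<eta> = 0"
proof -
  define l where "l = inv (D \<circ> inv B \<circ> H) (D (inv B F))"
  have \<eta>_l: "\<eta> = inv B (H l) - inv B F"
    by (simp add: \<eta> l_def)
  have "B \<in> Lin s s"
    using B by (simp add: invertible_op_def)
  then have "B \<eta> = H l - F"
    by (simp add: \<eta>_l Lin_diff invertible_op_inv_right[OF B])
  then have "P (B \<eta>) = - P F"
    by (simp add: Lin_diff[OF P] PH)
  moreover have "D (inv B (H l)) = D (inv B F)"
    using invertible_op_inv_right[OF S, of "D (inv B F)"] by (simp add: l_def)
  then have "D \<eta> = 0"
    by (simp add: \<eta>_l Lin_diff[OF D])
  ultimately show ?thesis ..
qed

theorem lemma1p1:
  "(\<forall>(s :: real \<Rightarrow> 'a::ab_group_add \<Rightarrow> 'a) (t :: real \<Rightarrow> 'b::ab_group_add \<Rightarrow> 'b)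
        P B F D H \<eta>.
      fin_dim s \<and> fin_dim t
      \<and> affine_projection s P \<and> invertible_op s B \<and> D \<in> Lin s t
      \<and> H \<in> Lin t s \<and> (\<forall>x. P (H x) = 0) \<and> invertible_op t (D \<circ> inv B \<circ> H)
      \<and> \<eta> = - inv B F + inv B (H (inv (D \<circ> inv B \<circ> H) (D (inv B F))))
      \<longrightarrow> P (B \<eta>) = - P F \<and> D \<eta> = 0)
   \<and>
   (\<forall>(s :: complex \<Rightarrow> 'a::ab_group_add \<Rightarrow> 'a) (t :: complex \<Rightarrow> 'b::ab_group_add \<Rightarrow> 'b)
        P B F D H \<eta>.
      fin_dim s \<and> fin_dim t
      \<and> affine_projection s P \<and> invertible_op s B \<and> D \<in> Lin s t
      \<and> H \<in> Lin t s \<and> (\<forall>x. P (H x) = 0) \<and> invertible_op t (D \<circ> inv B \<circ> H)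
      \<and> \<eta> = - inv B F + inv B (H (inv (D \<circ> inv B \<circ> H) (D (inv B F))))
      \<longrightarrow> P (B \<eta>) = - P F \<and> D \<eta> = 0)"
  by (intro conjI[where P = "All _"] allI impI; elim conjE;
      rule multiplier_solves_constrained_equation) (auto simp: affine_projection_def)

end
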